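(* Let $\mathbb{F}$ be an algebraically closed field with $\mathrm{Char}(\mathbb{F})=3$, and let $i\in\mathbb{F}$ be a fixed element with $i^2=-1$. Then any nontrivial $2$-dimensional Jordan algebra over $\mathbb{F}$ is isomorphic to one and only one of the following algebras, given by their matrices of structure constants (different values of a parameter count as different algebras in the list): $$J_{1,3}=\begin{pmatrix}-1&0&0&1\\0&1&-1&0\end{pmatrix},\qquad J_{2,3}=\begin{pmatrix}-1&0&0&1\\0&-1&-1&0\end{pmatrix},$$ $$J_{3,3}(\alpha_1)=\begin{pmatrix}\alpha_1&0&0&0\\0&-1-\alpha_1&-\alpha_1+1&0\end{pmatrix},\ \text{where }\alpha_1\in\mathbb{F},\ \alpha_1\neq-1\pm i,$$ $$J_{4,3}(\alpha_1)=\begin{pmatrix}\alpha_1&0&0&0\\0&\sqrt{\alpha_1-\alpha_1^2}&-\alpha_1+1&0\end{pmatrix},\ \text{where }\alpha_1\in\mathbb{F},$$ $$J_{5,3}(\alpha_1)=\begin{pmatrix}\alpha_1&0&0&0\\0&-\sqrt{\alpha_1-\alpha_1^2}&-\alpha_1+1&0\end{pmatrix},\ \text{where }\alpha_1\in\mathbb{F},\ \alpha_1\neq0,1,$$ $$J_{6,3}=\begin{pmatrix}-1+i&0&0&0\\1&-i&-1-i&0\end{pmatrix},\qquad J_{7,3}=\begin{pmatrix}-1-i&0&0&0\\1&i&-1+i&0\end{pmatrix},$$ $$J_{8,3}=\begin{pmatrix}-1+i&0&0&0\\0&-1-i&1-i&0\end{pmatrix},\qquad J_{9,3}=\begin{pmatrix}-1-i&0&0&0\\0&-1+i&1+i&0\end{pmatrix},$$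 $$J_{10,3}=\begin{pmatrix}0&1&1&0\\0&0&0&-1\end{pmatrix},\qquad J_{11,3}=\begin{pmatrix}0&0&0&0\\1&0&0&0\end{pmatrix}.$$
   Context: An algebra over a field $\mathbb{F}$ is an $\mathbb{F}$-vector space $\mathbb{A}$ with a bilinear multiplication $\cdot$ (not assumed associative, commutative or unital); it is nontrivial if the multiplication is not identically zero. Two algebras are isomorphic if there is an invertible linear map between them preserving the multiplication. An algebra $\mathbb{A}$ is a Jordan algebra if $(\mathbf{u}\cdot\mathbf{v})\cdot\mathbf{u}^2=\mathbf{u}\cdot(\mathbf{v}\cdot\mathbf{u}^2)$ for all $\mathbf{u},\mathbf{v}\in\mathbb{A}$, where $\mathbf{u}^2=\mathbf{u}\cdot\mathbf{u}$; commutativity is NOT assumed. The matrix of structure constants $A=\begin{pmatrix}\alpha_1&\alpha_2&\alpha_3&\alpha_4\\\beta_1&\beta_2&\beta_3&\beta_4\end{pmatrix}$ of a $2$-dimensional algebra with respect to a basis $(e^1,e^2)$ is defined by $e^1\cdot e^1=\alpha_1e^1+\beta_1e^2$, $e^1\cdot e^2=\alpha_2e^1+\beta_2e^2$, $e^2\cdot e^1=\alpha_3e^1+\beta_3e^2$, $e^2\cdot e^2=\alpha_4e^1+\beta_4e^2$. An algebra is identified with its matrix of structure constants. For $a\in\mathbb{F}$, $\sqrt a$ denotes a fixed chosen square root of $a$ in $\mathbb{F}$. *)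

theory Defs
  imports "HOL-Analysis.Cartesian_Space" "HOL-Computational_Algebra.Polynomial"
begin

locale nonassoc_algebra = vector_space scale
  for scale :: "'a::field \<Rightarrow> 'b::ab_group_add \<Rightarrow> 'b" +
  fixes mul :: "'b \<Rightarrow> 'b \<Rightarrow> 'b"
  assumes linear_right: "\<And>u. Vector_Spaces.linear scale scale (\<lambda>v. mul u v)"
    and linear_left: "\<And>v. Vector_Spaces.linear scale scale (\<lambda>u. mul u v)"

(* Commutativity is deliberately not part of the definition. *)
locale jordan_algebra = nonassoc_algebra +
  assumes jordan_identity: "mul (mul u v) (mul u u) = mul u (mul v (mul u u))"

definition nontrivial_mul :: "('b \<Rightarrow> 'b \<Rightarrow> 'b::zero) \<Rightarrow> bool" where
  "nontrivial_mul mul \<longleftrightarrow> (\<exists>u v. mul u v \<noteq> 0)"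

definition isomorphic_algebras ::
  "('a::field \<Rightarrow> 'b::ab_group_add \<Rightarrow> 'b) \<Rightarrow> ('b \<Rightarrow> 'b \<Rightarrow> 'b) \<Rightarrow>
   ('a \<Rightarrow> 'c::ab_group_add \<Rightarrow> 'c) \<Rightarrow> ('c \<Rightarrow> 'c \<Rightarrow> 'c) \<Rightarrow> bool" where
  "isomorphic_algebras scale1 mul1 scale2 mul2 \<longleftrightarrow>
     (\<exists>f. Vector_Spaces.linear scale1 scale2 f \<and> bij f \<and>
          (\<forall>u v. f (mul1 u v) = mul2 (f u) (f v)))"

(* The multiplication on the space of column vectors of length 2 whose matrix of structure
   constants with respect to the standard basis is A: row k of A lists the k-th coordinates of
   the products e1 e1, e1 e2, e2 e1, e2 e2, in this order. *)
definition msc_mul :: "'a::field ^ 4 ^ 2 \<Rightarrow> 'a ^ 2 \<Rightarrow> 'a ^ 2 \<Rightarrow> 'a ^ 2" where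
  "msc_mul A u v =
     (\<chi> k. A $ k $ 1 * (u $ 1 * v $ 1) + A $ k $ 2 * (u $ 1 * v $ 2)
         + A $ k $ 3 * (u $ 2 * v $ 1) + A $ k $ 4 * (u $ 2 * v $ 2))"

lemma msc_mul_axis:
  fixes A :: "'a::field ^ 4 ^ 2"
  defines "e1 \<equiv> axis 1 1" and "e2 \<equiv> axis 2 1"
  shows "msc_mul A e1 e1 = A $ 1 $ 1 *s e1 + A $ 2 $ 1 *s e2"
    and "msc_mul A e1 e2 = A $ 1 $ 2 *s e1 + A $ 2 $ 2 *s e2"
    and "msc_mul A e2 e1 = A $ 1 $ 3 *s e1 + A $ 2 $ 3 *s e2"
    and "msc_mul A e2 e2 = A $ 1 $ 4 *s e1 + A $ 2 $ 4 *s e2"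
  unfolding e1_def e2_def by (simp_all add: msc_mul_def vec_eq_iff axis_def forall_2)

lemma nonassoc_algebra_msc_mul: "nonassoc_algebra (*s) (msc_mul A)"
  by unfold_locales
     (auto simp: msc_mul_def vec_eq_iff algebra_simps)

(* Entries of the list are told apart by their labels, not by their matrices. *)
datatype 'a label =
    J1 | J2 | J3 'a | J4 'a | J5 'a | J6 | J7 | J8 | J9 | J10 | J11

fun admissible :: "'a::field \<Rightarrow> 'a label \<Rightarrow> bool" where
  "admissible i (J3 a) \<longleftrightarrow> a \<noteq> -1 + i \<and> a \<noteq> -1 - i"
| "admissible i (J5 a) \<longleftrightarrow> a \<noteq> 0 \<and> a \<noteq> 1"
| "admissible i _ \<longleftrightarrow> True"

(* i is a chosen square root of -1, and rt a choice of a square root of every field element. *)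
fun label_msc :: "'a::field \<Rightarrow> ('a \<Rightarrow> 'a) \<Rightarrow> 'a label \<Rightarrow> 'a ^ 4 ^ 2" where
  "label_msc i rt J1 = vector [vector [-1, 0, 0, 1],
                               vector [0, 1, -1, 0]]"
| "label_msc i rt J2 = vector [vector [-1, 0, 0, 1],
                               vector [0, -1, -1, 0]]"
| "label_msc i rt (J3 a) = vector [vector [a, 0, 0, 0],
                                   vector [0, -1 - a, -a + 1, 0]]"
| "label_msc i rt (J4 a) = vector [vector [a, 0, 0, 0],
                                   vector [0, rt (a - a\<^sup>2), -a + 1, 0]]"
| "label_msc i rt (J5 a) = vector [vector [a, 0, 0, 0],
                                   vector [0, - rt (a - a\<^sup>2), -a + 1, 0]]"
| "label_msc i rt J6 = vector [vector [-1 + i, 0, 0, 0],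
                               vector [1, -i, -1 - i, 0]]"
| "label_msc i rt J7 = vector [vector [-1 - i, 0, 0, 0],
                               vector [1, i, -1 + i, 0]]"
| "label_msc i rt J8 = vector [vector [-1 + i, 0, 0, 0],
                               vector [0, -1 - i, 1 - i, 0]]"
| "label_msc i rt J9 = vector [vector [-1 - i, 0, 0, 0],
                               vector [0, -1 + i, 1 + i, 0]]"
| "label_msc i rt J10 = vector [vector [0, 1, 1, 0],
                                vector [0, 0, 0, -1]]"
| "label_msc i rt J11 = vector [vector [0, 0, 0, 0],
                                vector [1, 0, 0, 0]]"

(* The index 4 of the type 4 equals 0, yet vector still puts its fourth argument there. *)
lemma vector_4_nth:
  "(vector [w, x, y, z] :: 'a::zero ^ 4) $ 1 = w"
  "(vector [w, x, y, z] :: 'a::zero ^ 4) $ 2 = x"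
  "(vector [w, x, y, z] :: 'a::zero ^ 4) $ 3 = y"
  "(vector [w, x, y, z] :: 'a::zero ^ 4) $ 4 = z"
  by (simp_all add: vector_def)

end

theory Submission
  imports Defs
begin

text \<open>
  \<^emph>\<open>Why the classification holds.\<close>  The cubic form that vanishes when a vector and its square
  are dependent has a nontrivial zero, because the field is algebraically closed.  So there is a
  nonzero \<open>e\<close> with \<open>e e = \<lambda> e\<close>, and after rescaling \<open>e\<close> is an idempotent or has square zero
  (\<open>eigenvector_exists\<close>).  Completing \<open>e\<close> to a basis \<open>(e, f)\<close> and reading the Jordan identity,
  together with its linearization (\<open>jordan_linearized\<close>), in coordinates leaves few possibilities
  (\<open>square_zero_cases\<close>, \<open>idempotent_cases\<close>).  Either the algebra is \<open>J1\<close> or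
  \<open>J2\<close>, or it is \<^emph>\<open>triangular\<close>: some basis satisfies \<open>e e = a e + s f\<close>, \<open>e f = b f\<close>,
  \<open>f e = c f\<close> and \<open>f f = 0\<close>, so that \<open>f\<close> spans an ideal with zero multiplication
  (\<open>normal_forms\<close>).

  For a triangular algebra the Jordan identity forces \<open>(b\<^sup>2 - a c) (b + c - a) = 0\<close> and
  \<open>s (b\<^sup>2 - a c) = 0\<close> (\<open>tri_conditions\<close>).  Replacing \<open>e\<close>
  by \<open>e + t f\<close> removes \<open>s\<close> unless \<open>b + c = a\<close>, and rescaling the basis multiplies \<open>(a, b, c)\<close> by
  an arbitrary nonzero scalar.  If \<open>a + c \<noteq> 0\<close> the normalization \<open>a + c = 1\<close> turns the two factors
  into \<open>b = \<plusminus> \<surd>(a - a\<^sup>2)\<close>, which gives \<open>J4\<close> and \<open>J5\<close>, and \<open>b = -1 - a\<close>, which gives \<open>J3\<close>; the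
  two factors vanish together exactly for \<open>a = -1 \<plusminus> i\<close>, and these are the only values for which
  a nonzero \<open>s\<close> can survive while \<open>a \<noteq> 0\<close>: this gives \<open>J6\<close> and \<open>J7\<close>.  If \<open>a + c = 0\<close> only the
  three directions \<open>J8\<close>, \<open>J9\<close>, \<open>J10\<close> remain, and \<open>a = b = c = 0\<close> is \<open>J11\<close>.

  Conversely, in a triangular algebra with \<open>(a, b, c) \<noteq> 0\<close> the line spanned by \<open>f\<close> is determined
  by the algebra.  Hence \<open>(a, b, c)\<close> is an invariant up to a common scalar, and so is the
  vanishing of \<open>s\<close> when \<open>b + c = a\<close> (\<open>tri_unique\<close>).  These invariants separate the triangular
  labels.  \<open>J1\<close> and \<open>J2\<close> have no ideal of this kind, and \<open>J2\<close> is commutative while \<open>J1\<close> is not.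
\<close>

section \<open>Square roots of minus one in characteristic 3\<close>

text \<open>
  Characteristic 3 is expressed as \<open>2 = -1\<close>, the form in which it simplifies numerals.
\<close>

lemma eq_minus_self:
  fixes x :: "'a::field"
  assumes "(2 :: 'a) = -1" "x = - x"
  shows "x = 0"
proof -
  have "x + x = 0"
    using assms(2) by (metis add.right_inverse)
  moreover have "x + x = - x"
    using assms(1) by (metis mult_2 mult_minus1)
  ultimately show ?thesis
    by simp
qed

text \<open>
  The elements \<open>-1 + i\<close> and \<open>-1 - i\<close> are the two roots of \<open>x\<^sup>2 - x - 1\<close>, and they are the
  parameters that \<open>J3\<close> excludes.
\<close>

lemma root_of_minus_one:
  fixes i :: "'a::field"
  assumes ii: "i * i = -1" and two: "(2 :: 'a) = -1"
  shows "i * i = -1" "i * (i * x) = - x" "i + i = - i" "i \<noteq> 0"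
    "(-1 + i) * (-1 - i) = -1" "-1 + i \<noteq> 0" "-1 - i \<noteq> 0"
proof -
  show "i * i = -1"
    by fact
  show "i * (i * x) = - x"
    using ii by (simp flip: mult.assoc)
  show "i + i = - i"
    using two by (metis mult_2 mult_minus1)
  show "i \<noteq> 0"
    using ii by auto
  show norm: "(-1 + i) * (-1 - i) = -1"
    using ii by (simp add: algebra_simps two)
  show "-1 + i \<noteq> 0"
    using norm by (metis mult_zero_left neg_equal_0_iff_equal zero_neq_one)
  show "-1 - i \<noteq> 0"
    using norm by (metis mult_zero_right neg_equal_0_iff_equal zero_neq_one)
qed

lemma root_of_minus_one_distinct:
  fixes i :: "'a::field"
  assumes "i * i = -1" and two: "(2 :: 'a) = -1"
  shows "i \<noteq> - i" "i \<noteq> 1" "i \<noteq> -1"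
proof -
  show "i \<noteq> - i"
    using eq_minus_self[OF two] root_of_minus_one(4)[OF assms] by blast
  show "i \<noteq> 1" "i \<noteq> -1"
    using assms(1) eq_minus_self[OF two, of 1] by auto
qed

section \<open>Bases and structure constants of plane algebras\<close>

abbreviation msc ::
  "'a::zero \<Rightarrow> 'a \<Rightarrow> 'a \<Rightarrow> 'a \<Rightarrow> 'a \<Rightarrow> 'a \<Rightarrow> 'a \<Rightarrow> 'a \<Rightarrow> 'a ^ 4 ^ 2" where
  "msc a1 a2 a3 a4 b1 b2 b3 b4 \<equiv> vector [vector [a1, a2, a3, a4], vector [b1, b2, b3, b4]]"

text \<open>
  The algebras with a basis \<open>(e, f)\<close> such that \<open>e e = a e + s f\<close>, \<open>e f = b f\<close>, \<open>f e = c f\<close> and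
  \<open>f f = 0\<close>.
\<close>

abbreviation tri_msc :: "'a::zero \<Rightarrow> 'a \<Rightarrow> 'a \<Rightarrow> 'a \<Rightarrow> 'a ^ 4 ^ 2" where
  "tri_msc a s b c \<equiv> msc a 0 0 0 s b c 0"

abbreviation J1_msc :: "'a::field ^ 4 ^ 2" where
  "J1_msc \<equiv> msc (-1) 0 0 1 0 1 (-1) 0"

abbreviation J2_msc :: "'a::field ^ 4 ^ 2" where
  "J2_msc \<equiv> msc (-1) 0 0 1 0 (-1) (-1) 0"

lemmas msc_nth = vector_2 vector_4_nth

locale plane_algebra = nonassoc_algebra scale mul
  for scale :: "'a::field \<Rightarrow> 'b::ab_group_add \<Rightarrow> 'b" and mul :: "'b \<Rightarrow> 'b \<Rightarrow> 'b" +
  assumes dim_UNIV: "dim (UNIV :: 'b set) = 2"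
begin

definition comb :: "'b \<Rightarrow> 'b \<Rightarrow> 'a \<Rightarrow> 'a \<Rightarrow> 'b" where
  "comb e f x y = scale x e + scale y f"

text \<open>
  Linear independence of the ordered pair; by \<open>frame_span\<close> below, a frame is a basis.
\<close>

definition frame :: "'b \<Rightarrow> 'b \<Rightarrow> bool" where
  "frame e f \<longleftrightarrow> (\<forall>x y. comb e f x y = 0 \<longrightarrow> x = 0 \<and> y = 0)"

definition has_msc :: "'b \<Rightarrow> 'b \<Rightarrow> 'a ^ 4 ^ 2 \<Rightarrow> bool" where
  "has_msc e f A \<longleftrightarrow>
     mul e e = comb e f (A $ 1 $ 1) (A $ 2 $ 1) \<and> mul e f = comb e f (A $ 1 $ 2) (A $ 2 $ 2) \<and>
     mul f e = comb e f (A $ 1 $ 3) (A $ 2 $ 3) \<and> mul f f = comb e f (A $ 1 $ 4) (A $ 2 $ 4)"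

definition realizes :: "'a ^ 4 ^ 2 \<Rightarrow> bool" where
  "realizes A \<longleftrightarrow> (\<exists>e f. frame e f \<and> has_msc e f A)"

lemma mul_linear:
  "mul (u + v) w = mul u w + mul v w" "mul w (u + v) = mul w u + mul w v"
  "mul (scale x u) v = scale x (mul u v)" "mul u (scale x v) = scale x (mul u v)"
  using linear_left[of w] linear_right[of w] linear_left[of v] linear_right[of u]
  by (simp_all add: Vector_Spaces.linear_iff)

lemma comb_add: "comb e f x y + comb e f z w = comb e f (x + z) (y + w)"
  by (simp add: comb_def algebra_simps)

lemma scale_comb: "scale c (comb e f x y) = comb e f (c * x) (c * y)"
  by (simp add: comb_def algebra_simps)

lemma comb_comb:
  "comb (comb e f x y) (comb e f z w) p q = comb e f (p * x + q * z) (p * y + q * w)"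
  by (simp add: comb_def algebra_simps)

lemma comb_unit: "comb e f 1 0 = e" "comb e f 0 1 = f" "comb e f 0 0 = 0"
  by (simp_all add: comb_def)

lemma comb_swap: "comb f e x y = comb e f y x"
  by (simp add: comb_def add.commute)

lemma frameD: "frame e f \<Longrightarrow> comb e f x y = 0 \<Longrightarrow> x = 0 \<and> y = 0"
  unfolding frame_def by blast

lemma comb_eq_iff:
  assumes "frame e f"
  shows "comb e f x y = comb e f z w \<longleftrightarrow> x = z \<and> y = w"
proof
  assume "comb e f x y = comb e f z w"
  then have "comb e f (x - z) (y - w) = 0"
    by (simp add: comb_def algebra_simps)
  then show "x = z \<and> y = w"
    using frameD[OF assms] by fastforce
qed auto

lemma comb_eq_0_iff:
  assumes "frame e f"
  shows "comb e f x y = 0 \<longleftrightarrow> x = 0 \<and> y = 0"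
  using comb_eq_iff[OF assms, of x y 0 0] by (simp add: comb_unit)

lemma frame_swap: "frame e f \<Longrightarrow> frame f e"
  by (auto simp: frame_def comb_swap)

text \<open>
  Two combinations of a basis are again independent exactly when their determinant does not vanish.
\<close>

lemma frame_comb_iff:
  assumes "frame e f"
  shows "frame (comb e f x y) (comb e f z w) \<longleftrightarrow> x * w - y * z \<noteq> 0"
proof
  assume *: "frame (comb e f x y) (comb e f z w)"
  show "x * w - y * z \<noteq> 0"
  proof
    assume det: "x * w - y * z = 0"
    have "comb (comb e f x y) (comb e f z w) w (- y) = 0"
         "comb (comb e f x y) (comb e f z w) z (- x) = 0"
      using det by (simp_all add: comb_comb comb_eq_0_iff[OF assms] algebra_simps)
    then have "w = 0 \<and> y = 0 \<and> z = 0 \<and> x = 0"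
      using frameD[OF *] by fastforce
    then have "comb (comb e f x y) (comb e f z w) 1 0 = 0"
      by (simp add: comb_def)
    then show False
      using frameD[OF *] by fastforce
  qed
next
  assume det: "x * w - y * z \<noteq> 0"
  have "p = 0 \<and> q = 0" if "p * x + q * z = 0" "p * y + q * w = 0" for p q
  proof -
    have "p * (x * w - y * z) = 0" "q * (x * w - y * z) = 0"
      using that by algebra+
    then show ?thesis
      using det by simp
  qed
  then show "frame (comb e f x y) (comb e f z w)"
    unfolding frame_def comb_comb comb_eq_0_iff[OF assms] by blast
qed

lemma frame_exists: "\<exists>e f. frame e f \<and> (\<forall>u. \<exists>x y. u = comb e f x y)"
proof -
  obtain B where B: "independent B" "UNIV \<subseteq> span B" "card B = dim (UNIV :: 'b set)"
    by (rule basis_exists[of UNIV])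
  then obtain e f where ef: "B = {e, f}" "e \<noteq> f"
    by (auto simp: dim_UNIV card_2_iff)
  have "e \<notin> span {f}" "f \<noteq> 0"
    using B(1) ef independent_insert[of e "{f}"] dependent_zero[of B] by auto
  have "frame e f"
    unfolding frame_def comb_def
  proof (intro allI impI)
    fix x y
    assume *: "scale x e + scale y f = 0"
    have "x = 0"
    proof (rule ccontr)
      assume "x \<noteq> 0"
      then have "e = scale (inverse x) (scale x e)"
        by simp
      also have "scale x e = scale (- y) f"
        using * by (simp add: add_eq_0_iff2)
      finally have "e \<in> span {f}"
        by (metis span_base span_scale singletonI)
      then show False
        using \<open>e \<notin> span {f}\<close> by simp
    qed
    then show "x = 0 \<and> y = 0"
      using * \<open>f \<noteq> 0\<close> by simp
  qed
  moreover have "\<exists>x y. u = comb e f x y" for u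
  proof -
    have "u \<in> span {e, f}"
      using B ef by auto
    then obtain x y where "u - scale x e = scale y f"
      by (auto simp: span_insert span_singleton)
    then show ?thesis
      unfolding comb_def by (metis add.commute diff_add_cancel)
  qed
  ultimately show ?thesis
    by blast
qed

text \<open>
  One spanning frame exists by \<open>frame_exists\<close>.  Any other frame has a nonzero determinant with
  respect to it, so Cramer's rule expresses every vector in the other frame too.
\<close>

lemma frame_span:
  assumes "frame e f"
  obtains x y where "u = comb e f x y"
proof -
  obtain e0 f0 where fr: "frame e0 f0" and sp: "\<And>u. \<exists>x y. u = comb e0 f0 x y"
    using frame_exists by blast
  obtain x y where e: "e = comb e0 f0 x y"
    using sp by blast
  obtain z w where f: "f = comb e0 f0 z w"
    using sp by blast
  obtain p q where u: "u = comb e0 f0 p q"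
    using sp by blast
  have "x * w - y * z \<noteq> 0"
    using assms unfolding e f frame_comb_iff[OF fr] .
  then have "u = comb e f ((p * w - q * z) / (x * w - y * z)) ((q * x - p * y) / (x * w - y * z))"
    unfolding u e f comb_comb comb_eq_iff[OF fr]
    by (simp add: divide_simps) (simp add: algebra_simps)
  then show thesis
    by (rule that)
qed

lemma frame_extend:
  assumes "e \<noteq> 0"
  obtains f where "frame e f"
proof -
  obtain e0 f0 where fr: "frame e0 f0"
    using frame_exists by blast
  obtain x y where e: "e = comb e0 f0 x y"
    using frame_span[OF fr] .
  have "x \<noteq> 0 \<or> y \<noteq> 0"
    using assms by (auto simp: e comb_unit)
  then have "frame e (comb e0 f0 0 1) \<or> frame e (comb e0 f0 1 0)"
    by (auto simp: e frame_comb_iff[OF fr])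
  then show thesis
    using that by blast
qed

lemma frame_has_msc:
  assumes "frame e f"
  obtains a1 a2 a3 a4 b1 b2 b3 b4 where "has_msc e f (msc a1 a2 a3 a4 b1 b2 b3 b4)"
proof -
  obtain a1 b1 where "mul e e = comb e f a1 b1"
    using frame_span[OF assms] .
  moreover obtain a2 b2 where "mul e f = comb e f a2 b2"
    using frame_span[OF assms] .
  moreover obtain a3 b3 where "mul f e = comb e f a3 b3"
    using frame_span[OF assms] .
  moreover obtain a4 b4 where "mul f f = comb e f a4 b4"
    using frame_span[OF assms] .
  ultimately have "has_msc e f (msc a1 a2 a3 a4 b1 b2 b3 b4)"
    by (simp add: has_msc_def msc_nth)
  then show thesis
    by (rule that)
qed

text \<open>
  The multiplication in coordinates.  With this rule every identity between products becomes a pair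
  of polynomial identities in the structure constants.
\<close>

lemma mul_comb:
  assumes "has_msc e f A"
  shows "mul (comb e f x y) (comb e f z w) =
    comb e f (A$1$1 * (x * z) + A$1$2 * (x * w) + A$1$3 * (y * z) + A$1$4 * (y * w))
             (A$2$1 * (x * z) + A$2$2 * (x * w) + A$2$3 * (y * z) + A$2$4 * (y * w))"
proof -
  have "mul (comb e f x y) (comb e f z w) =
      scale (x * z) (mul e e) + scale (x * w) (mul e f) +
      scale (y * z) (mul f e) + scale (y * w) (mul f f)"
    by (simp add: comb_def mul_linear algebra_simps)
  then show ?thesis
    using assms by (simp add: has_msc_def scale_comb comb_add mult.commute)
qed

lemma realizes_comb:
  assumes "frame e f" "has_msc e f A" "x * w - y * z \<noteq> 0"
    and "has_msc (comb e f x y) (comb e f z w) A'"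
  shows "realizes A'"
  using assms frame_comb_iff[OF assms(1)] unfolding realizes_def by blast

text \<open>
  The standard basis of the column vectors corresponds under an isomorphism to a basis with the
  same structure constants, and conversely the coordinates with respect to such a basis are an
  isomorphism.  From here on the classification takes place inside one algebra.
\<close>

lemma isomorphic_iff_realizes:
  "isomorphic_algebras scale mul (*s) (msc_mul A) \<longleftrightarrow> realizes A"
proof
  assume "isomorphic_algebras scale mul (*s) (msc_mul A)"
  then obtain g where lin: "Vector_Spaces.linear scale (*s) g" and bij: "bij g"
    and hom: "\<And>u v. g (mul u v) = msc_mul A (g u) (g v)"
    unfolding isomorphic_algebras_def by blast
  define e f where "e = inv g (axis 1 1)" and "f = inv g (axis 2 1)"
  have g: "g e = axis 1 1" "g f = axis 2 1"
    using bij by (simp_all add: e_def f_def bij_is_surj surj_f_inv_f)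
  have g_comb: "g (comb e f x y) = x *s axis 1 1 + y *s axis 2 1" for x y
    using lin by (simp add: comb_def Vector_Spaces.linear_iff g)
  have "g 0 = 0"
    using lin by (metis Vector_Spaces.linear_def module_hom.zero)
  have "frame e f"
    unfolding frame_def
  proof (intro allI impI)
    fix x y
    assume "comb e f x y = 0"
    then have "x *s axis 1 1 + y *s axis 2 1 = (0 :: 'a ^ 2)"
      using g_comb \<open>g 0 = 0\<close> by metis
    then show "x = 0 \<and> y = 0"
      by (simp add: vec_eq_iff forall_2 axis_def)
  qed
  moreover have "has_msc e f A"
    unfolding has_msc_def
    by (auto intro!: injD[OF bij_is_inj[OF bij]] simp: hom g g_comb msc_mul_axis)
  ultimately show "realizes A"
    unfolding realizes_def by blast
next
  assume "realizes A"
  then obtain e f where fr: "frame e f" and A: "has_msc e f A"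
    unfolding realizes_def by blast
  define h :: "'a ^ 2 \<Rightarrow> 'b" where "h v = comb e f (v $ 1) (v $ 2)" for v
  define g where "g = inv h"
  have "inj h"
    by (auto simp: inj_def h_def comb_eq_iff[OF fr] vec_eq_iff forall_2)
  moreover have "surj h"
  proof (rule surjI)
    fix u
    obtain x y where "u = comb e f x y"
      using frame_span[OF fr] .
    then have "h (vector [x, y]) = u"
      by (simp add: h_def)
    then show "h (SOME v. h v = u) = u"
      by (rule someI)
  qed
  ultimately have "bij h"
    by (simp add: bij_def)
  then have hg: "h (g u) = u" and gh: "g (h v) = v" for u v
    by (simp_all add: g_def bij_is_surj surj_f_inv_f bij_is_inj inv_f_f)
  have h_add: "h (v + w) = h v + h w" and h_scale: "h (c *s v) = scale c (h v)"
    and h_mul: "h (msc_mul A v w) = mul (h v) (h w)" for v w c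
    by (simp_all add: h_def comb_add scale_comb mul_comb[OF A] msc_mul_def)
  have "Vector_Spaces.linear scale (*s) g"
    unfolding Vector_Spaces.linear_iff
  proof (intro conjI allI)
    show "vector_space scale" ..
    show "vector_space ((*s) :: 'a \<Rightarrow> 'a ^ 2 \<Rightarrow> _)" ..
    show "g (u + v) = g u + g v" for u v
      by (metis h_add hg gh)
    show "g (scale c u) = c *s g u" for c u
      by (metis h_scale hg gh)
  qed
  moreover have "bij g"
    unfolding g_def using \<open>bij h\<close> by (rule bij_imp_bij_inv)
  moreover have "g (mul u v) = msc_mul A (g u) (g v)" for u v
    by (metis h_mul hg gh)
  ultimately show "isomorphic_algebras scale mul (*s) (msc_mul A)"
    unfolding isomorphic_algebras_def by blast
qed

lemma realizes_swap:
  assumes "realizes (msc a1 a2 a3 a4 b1 b2 b3 b4)"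
  shows "realizes (msc b4 b3 b2 b1 a4 a3 a2 a1)"
  using assms unfolding realizes_def has_msc_def msc_nth
  by (metis comb_swap frame_swap)

section \<open>Invariants\<close>

text \<open>
  Suppose that \<open>f' = z e + w f\<close> with \<open>z \<noteq> 0\<close>.  Then \<open>f'\<close> can only have square zero and span an ideal
  if \<open>a = b = c = 0\<close>.  So \<open>f'\<close> is a multiple of \<open>f\<close>, and if \<open>e' = x e + y f\<close>, then \<open>(a', b', c')\<close>
  is \<open>x (a, b, c)\<close>, since \<open>a\<close> is the multiplication modulo \<open>f\<close> and \<open>b\<close>, \<open>c\<close> are the actions of \<open>e\<close>
  on \<open>f\<close>.  The component \<open>s'\<close> changes with \<open>y\<close> through the factor \<open>b + c - a\<close> only.
\<close>

lemma tri_unique: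
  assumes "realizes (tri_msc a s b c)" "realizes (tri_msc a' s' b' c')"
    and nz: "\<not> (a = 0 \<and> b = 0 \<and> c = 0)"
  shows "\<exists>x. x \<noteq> 0 \<and> a' = x * a \<and> b' = x * b \<and> c' = x * c \<and>
             (b + c = a \<longrightarrow> (s = 0 \<longleftrightarrow> s' = 0))"
proof -
  obtain e f where fr: "frame e f" and M: "has_msc e f (tri_msc a s b c)"
    using assms(1) unfolding realizes_def by blast
  obtain e' f' where fr': "frame e' f'" and M': "has_msc e' f' (tri_msc a' s' b' c')"
    using assms(2) unfolding realizes_def by blast
  obtain x y where e': "e' = comb e f x y"
    using frame_span[OF fr] .
  obtain z w where f': "f' = comb e f z w"
    using frame_span[OF fr] .
  have det: "x * w - y * z \<noteq> 0"
    using fr' unfolding e' f' frame_comb_iff[OF fr] .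
  have eqs: "z * z * a = 0" "z * z * s + z * w * b + w * z * c = 0"
    "x * z * a = b' * z" "x * z * s + x * w * b + y * z * c = b' * w"
    "z * x * a = c' * z" "z * x * s + z * y * b + w * x * c = c' * w"
    "x * x * a = a' * x + s' * z" "x * x * s + x * y * b + y * x * c = a' * y + s' * w"
    using M' unfolding has_msc_def e' f' mul_comb[OF M] comb_comb comb_eq_iff[OF fr] msc_nth
    by (simp_all add: algebra_simps)
  have "z = 0"
  proof (rule ccontr)
    assume z: "z \<noteq> 0"
    then have a: "a = 0" and "b' = 0" "c' = 0"
      using eqs by auto
    have r: "z * s + w * b + w * c = 0"
      using z eqs(2) by algebra
    have "c * (x * w - y * z) = 0" "b * (x * w - y * z) = 0"
      using r eqs(4,6) \<open>b' = 0\<close> \<open>c' = 0\<close> by algebra+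
    then show False
      using a nz det by simp
  qed
  then have xw: "x \<noteq> 0" "w \<noteq> 0"
    using det by auto
  have "b' = x * b" "c' = x * c" "a' = x * a"
    using eqs \<open>z = 0\<close> xw by auto
  moreover have "s = 0 \<longleftrightarrow> s' = 0" if "b + c = a"
  proof -
    have "x * x * s = s' * w"
      using eqs(8) that \<open>a' = x * a\<close> by algebra
    then show ?thesis
      using xw by auto
  qed
  ultimately show ?thesis
    using xw by blast
qed

text \<open>
  The vectors of square zero in \<open>J1\<close> are the multiples of \<open>e + f\<close> and \<open>e - f\<close>, and neither of these
  lines is an ideal, because \<open>e\<close> acts on \<open>e\<close> and \<open>f\<close> with opposite signs.
\<close>

lemma J1_not_tri:
  assumes "realizes J1_msc" and two: "(2 :: 'a) \<noteq> 0"
  shows "\<not> realizes (tri_msc a s b c)"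
proof
  assume "realizes (tri_msc a s b c)"
  then obtain e' f' where fr': "frame e' f'" and M': "has_msc e' f' (tri_msc a s b c)"
    unfolding realizes_def by blast
  obtain e f where fr: "frame e f" and M: "has_msc e f J1_msc"
    using assms(1) unfolding realizes_def by blast
  obtain z w where f': "f' = comb e f z w"
    using frame_span[OF fr] .
  obtain x y where e: "e = comb e' f' x y"
    using frame_span[OF fr'] .
  have "f' \<noteq> 0"
    using frameD[OF fr', of 0 1] by (auto simp: comb_unit)
  then have "z \<noteq> 0 \<or> w \<noteq> 0"
    by (auto simp: f' comb_unit)
  moreover have "w * w = z * z"
  proof -
    have "mul f' f' = 0"
      using M' by (simp add: has_msc_def msc_nth comb_unit)
    then show ?thesis
      unfolding f' mul_comb[OF M] by (simp add: msc_nth comb_eq_0_iff[OF fr])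
  qed
  ultimately have zw: "z \<noteq> 0" "w \<noteq> 0"
    by auto
  have "mul e f' = scale (x * b) f'"
    using mul_comb[OF M', of x y 0 1] unfolding e comb_unit by (simp add: msc_nth comb_def)
  then have "mul (comb e f 1 0) (comb e f z w) = comb e f (x * b * z) (x * b * w)"
    by (simp add: comb_unit f' scale_comb)
  then have "- z = x * b * z" "w = x * b * w"
    unfolding mul_comb[OF M] comb_eq_iff[OF fr] by (simp_all add: msc_nth)
  then have "2 * z * w = 0"
    by algebra
  then show False
    using zw two by simp
qed

text \<open>
  Here zero is the only vector of square zero.
\<close>

lemma J2_not_tri:
  assumes "realizes J2_msc" and two: "(2 :: 'a) \<noteq> 0"
  shows "\<not> realizes (tri_msc a s b c)"
proof
  assume "realizes (tri_msc a s b c)"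
  then obtain e' f' where fr': "frame e' f'" and M': "has_msc e' f' (tri_msc a s b c)"
    unfolding realizes_def by blast
  obtain e f where fr: "frame e f" and M: "has_msc e f J2_msc"
    using assms(1) unfolding realizes_def by blast
  obtain z w where f': "f' = comb e f z w"
    using frame_span[OF fr] .
  have "mul f' f' = 0"
    using M' by (simp add: has_msc_def msc_nth comb_unit)
  then have "w * w - z * z = 0" "2 * (z * w) = 0"
    unfolding f' mul_comb[OF M] by (simp_all add: msc_nth comb_eq_0_iff[OF fr] algebra_simps)
  then have "z = 0 \<and> w = 0"
    using two by auto
  then have "f' = 0"
    by (simp add: f' comb_unit)
  then show False
    using frameD[OF fr', of 0 1] by (simp add: comb_unit)
qed

text \<open>
  Commutativity tells the two apart.
\<close>

lemma J1_J2_exclusive: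
  assumes "realizes J1_msc" and two: "(2 :: 'a) \<noteq> 0"
  shows "\<not> realizes J2_msc"
proof
  assume "realizes J2_msc"
  then obtain e' f' where fr': "frame e' f'" and M': "has_msc e' f' J2_msc"
    unfolding realizes_def by blast
  obtain e f where fr: "frame e f" and M: "has_msc e f J1_msc"
    using assms(1) unfolding realizes_def by blast
  have comm: "mul u v = mul v u" for u v
  proof -
    obtain x y where u: "u = comb e' f' x y"
      using frame_span[OF fr'] .
    obtain z w where v: "v = comb e' f' z w"
      using frame_span[OF fr'] .
    show ?thesis
      unfolding u v mul_comb[OF M'] by (simp add: msc_nth algebra_simps)
  qed
  have "comb e f 0 1 = comb e f 0 (-1)"
    using M comm[of e f] unfolding has_msc_def msc_nth by metis
  then have "(1 :: 'a) = -1"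
    by (simp add: comb_eq_iff[OF fr])
  then have "(2 :: 'a) = 0"
    by (metis add.left_inverse one_add_one)
  then show False
    using two by simp
qed

end

section \<open>Consequences of the Jordan identity\<close>

locale jordan_plane = jordan_algebra scale mul + plane_algebra scale mul
  for scale :: "'a::alg_closed_field \<Rightarrow> 'b::ab_group_add \<Rightarrow> 'b" and mul +
  assumes three: "(3 :: 'a) = 0"
begin

lemma two_eq: "(2 :: 'a) = -1"
proof -
  have "(2 :: 'a) = 3 - 1"
    by simp
  then show ?thesis
    using three by simp
qed

lemma two: "(2 :: 'a) \<noteq> 0"
  by (simp add: two_eq)

text \<open>
  The component of the Jordan identity at \<open>e + k f\<close> that is linear in \<open>f\<close>.  The identity is cubic
  in its first argument, so for \<open>k = 1\<close> and \<open>k = -1\<close> the linear and the quadratic component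
  separate once 2 is invertible.
\<close>

lemma jordan_linearized:
  "mul (mul e v) (mul e f + mul f e) + mul (mul f v) (mul e e) =
   mul e (mul v (mul e f + mul f e)) + mul f (mul v (mul e e))"
proof -
  define D where "D u = mul (mul u v) (mul u u) - mul u (mul v (mul u u))" for u
  define T where "T e f = mul (mul e v) (mul e f + mul f e) + mul (mul f v) (mul e e) -
    (mul e (mul v (mul e f + mul f e)) + mul f (mul v (mul e e)))" for e f
  have D0: "D u = 0" for u
    by (simp add: D_def jordan_identity)
  have "D (e + scale k f) =
      D e + scale k (T e f) + scale (k * k) (T f e) + scale (k * k * k) (D f)" for k
    by (simp add: D_def T_def mul_linear algebra_simps)
  from this[of 1] this[of "-1"] have "T e f + T f e = 0" "- T e f + T f e = 0"
    by (simp_all add: D0)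
  then have "T f e = T e f" "T e f + T f e = 0"
    by (simp_all only: add_eq_0_iff minus_minus)
  then have "T e f + T e f = 0"
    by simp
  then have "scale 2 (T e f) = 0"
    using scale_left_distrib[of 1 1 "T e f"] by simp
  then show ?thesis
    using two by (simp add: T_def)
qed

text \<open>
  The first condition is the \<open>f\<close>-component of the linearized identity for \<open>e, e, f\<close>.  The second is
  the \<open>f\<close>-component of \<open>(e e) (e e) = e (e (e e))\<close>.
\<close>

lemma tri_conditions:
  assumes "realizes (tri_msc a s b c)"
  shows "(b * b - a * c) * (b + c - a) = 0" "s * (b * b - a * c) = 0"
proof -
  obtain e f where fr: "frame e f" and M: "has_msc e f (tri_msc a s b c)"
    using assms unfolding realizes_def by blast
  \<comment> \<open>Writing \<open>e\<close> and \<open>f\<close> as combinations makes \<open>mul_comb\<close> applicable to all products at once.\<close>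
  show "s * (b * b - a * c) = 0"
    using jordan_identity[of "comb e f 1 0" "comb e f 1 0"]
    unfolding mul_comb[OF M] comb_add comb_eq_iff[OF fr] msc_nth by (elim conjE) algebra
  show "(b * b - a * c) * (b + c - a) = 0"
    using jordan_linearized[of "comb e f 1 0" "comb e f 1 0" "comb e f 0 1"]
    unfolding mul_comb[OF M] comb_add comb_eq_iff[OF fr] msc_nth by (elim conjE) algebra
qed

section \<open>Normal forms\<close>

text \<open>
  If \<open>e\<close> is not itself such a vector, look for one of the form \<open>x e + f\<close>.  Proportionality to its
  square is a cubic equation for \<open>x\<close>, whose leading coefficient is the \<open>f\<close>-component of \<open>e e\<close>.
\<close>

lemma eigenvector_exists: "\<exists>e l. e \<noteq> 0 \<and> mul e e = scale l e"
proof -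
  obtain e f where fr: "frame e f"
    using frame_exists by blast
  obtain a1 a2 a3 a4 b1 b2 b3 b4 where M: "has_msc e f (msc a1 a2 a3 a4 b1 b2 b3 b4)"
    using frame_has_msc[OF fr] .
  show ?thesis
  proof (cases "b1 = 0")
    case True
    then have "mul e e = scale a1 e"
      using M by (simp add: has_msc_def msc_nth comb_def)
    moreover have "e \<noteq> 0"
      using frameD[OF fr, of 1 0] by (auto simp: comb_unit)
    ultimately show ?thesis
      by blast
  next
    case False
    define p where "p = [:- a4, b4 - a2 - a3, b2 + b3 - a1, b1:]"
    have "degree p > 0"
      using False by (simp add: p_def)
    then obtain x where "poly p x = 0"
      using alg_closed_imp_poly_has_root by blast
    then have root: "b1 * x * x * x + (b2 + b3 - a1) * x * x + (b4 - a2 - a3) * x - a4 = 0"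
      by (simp add: p_def algebra_simps)
    have "mul (comb e f x 1) (comb e f x 1) = scale (b1 * x * x + (b2 + b3) * x + b4) (comb e f x 1)"
      unfolding mul_comb[OF M] scale_comb comb_eq_iff[OF fr] msc_nth
    proof (intro conjI)
      show "a1 * (x * x) + a2 * (x * 1) + a3 * (1 * x) + a4 * (1 * 1) =
          (b1 * x * x + (b2 + b3) * x + b4) * x"
        using root by algebra
    qed (simp add: algebra_simps)
    moreover have "comb e f x 1 \<noteq> 0"
      using frameD[OF fr, of x 1] by auto
    ultimately show ?thesis
      by blast
  qed
qed

text \<open>
  The left and the right multiplication by \<open>e\<close> commute and both fix \<open>e\<close>, so they can be diagonalized
  together, by replacing \<open>f\<close> with \<open>f + t e\<close>, as soon as one of them has an eigenvalue other than 1.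
  If both only have the eigenvalue 1, the linearized identity shows that they are the identity.
\<close>

lemma idempotent_msc:
  assumes "e \<noteq> 0" "mul e e = e"
  obtains f r b c s where "frame e f" "has_msc e f (msc 1 0 0 r 0 b c s)"
proof -
  obtain f where fr: "frame e f"
    using frame_extend[OF assms(1)] .
  obtain a1 p q a4 b1 b c b4 where M0: "has_msc e f (msc a1 p q a4 b1 b c b4)"
    using frame_has_msc[OF fr] .
  have "comb e f a1 b1 = comb e f 1 0"
    using M0 assms(2) by (simp add: has_msc_def msc_nth comb_unit)
  then have "a1 = 1" "b1 = 0"
    by (simp_all add: comb_eq_iff[OF fr])
  then have M: "has_msc e f (msc 1 p q a4 0 b c b4)"
    using M0 by simp
  have comm: "q + p * c = p + q * b"
    using jordan_identity[of "comb e f 1 0" "comb e f 0 1"]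
    unfolding mul_comb[OF M] comb_add comb_eq_iff[OF fr] msc_nth by (elim conjE) algebra
  have "\<exists>t. p + t - b * t = 0 \<and> q + t - c * t = 0"
  proof (cases "b = 1 \<and> c = 1")
    case True
    have lin: "mul (mul (comb e f 1 0) v) (mul (comb e f 1 0) (comb e f 0 1) + mul (comb e f 0 1) (comb e f 1 0)) +
          mul (mul (comb e f 0 1) v) (mul (comb e f 1 0) (comb e f 1 0)) =
        mul (comb e f 1 0) (mul v (mul (comb e f 1 0) (comb e f 0 1) + mul (comb e f 0 1) (comb e f 1 0))) +
          mul (comb e f 0 1) (mul v (mul (comb e f 1 0) (comb e f 1 0)))" for v
      by (rule jordan_linearized)
    have M1: "has_msc e f (msc 1 p q a4 0 1 1 b4)"
      using M True by simp
    have q: "q = 2 * p"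
      using lin[of "comb e f 1 0"]
      unfolding mul_comb[OF M1] comb_add comb_eq_iff[OF fr] msc_nth by (elim conjE) algebra
    have "2 * p * p + b4 * q - 2 * b4 * p - q * q = 0"
      using lin[of "comb e f 0 1"]
      unfolding mul_comb[OF M1] comb_add comb_eq_iff[OF fr] msc_nth by (elim conjE) algebra
    then have "2 * (p * p) = 0"
      unfolding q by (simp add: algebra_simps)
    then show ?thesis
      using q two True by simp
  next
    case False
    then have "b \<noteq> 1 \<or> c \<noteq> 1"
      by simp
    then show ?thesis
    proof
      assume "b \<noteq> 1"
      then have "p + p / (b - 1) - b * (p / (b - 1)) = 0 \<and> q + p / (b - 1) - c * (p / (b - 1)) = 0"
        using comm by (simp add: divide_simps) (simp add: algebra_simps)
      then show ?thesis
        by blast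
    next
      assume "c \<noteq> 1"
      then have "p + q / (c - 1) - b * (q / (c - 1)) = 0 \<and> q + q / (c - 1) - c * (q / (c - 1)) = 0"
        using comm by (simp add: divide_simps) (simp add: algebra_simps)
      then show ?thesis
        by blast
    qed
  qed
  then obtain t where t: "p + t = b * t" "q + t = c * t"
    by auto
  define f' where "f' = comb e f t 1"
  have fr': "frame e f'"
    using frame_comb_iff[OF fr, of 1 0 t 1] by (simp add: f'_def comb_unit)
  obtain r s where "mul f' f' = comb e f' r s"
    using frame_span[OF fr'] .
  moreover have "mul e f' = comb e f' 0 b"
    using mul_comb[OF M, of 1 0 t 1] t comb_comb[of e f 1 0 t 1]
    by (simp add: f'_def comb_unit msc_nth add.commute)
  moreover have "mul f' e = comb e f' 0 c"
    using mul_comb[OF M, of t 1 1 0] t comb_comb[of e f 1 0 t 1]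
    by (simp add: f'_def comb_unit msc_nth add.commute)
  ultimately have "has_msc e f' (msc 1 0 0 r 0 b c s)"
    using assms(2) by (simp add: has_msc_def msc_nth comb_unit)
  with fr' show thesis
    by (rule that)
qed

text \<open>
  Here \<open>e\<close> is a unit and the algebra is \<open>F[f] / (f\<^sup>2 - s f - r)\<close>.  Since \<open>-1/2 = 1\<close>, completing the
  square means passing to \<open>f + s e\<close>, whose square is \<open>(s\<^sup>2 + r) e\<close>.  A double root yields a
  triangular algebra; distinct roots yield the product of two copies of the field, which is \<open>J2\<close>.
\<close>

lemma unital_cases:
  assumes "realizes (msc 1 0 0 r 0 1 1 s)"
  shows "realizes (tri_msc 1 0 1 1) \<or> realizes J2_msc"
proof -
  obtain e f where fr: "frame e f" and M: "has_msc e f (msc 1 0 0 r 0 1 1 s)"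
    using assms unfolding realizes_def by blast
  have "s + s + s = 3 * s"
    by simp
  then have sq: "s + s + s = 0"
    using three by simp
  show ?thesis
  proof (cases "s * s + r = 0")
    case True
    have "has_msc (comb e f 1 0) (comb e f s 1) (tri_msc 1 0 1 1)"
      using True sq
      unfolding has_msc_def mul_comb[OF M] comb_comb comb_eq_iff[OF fr] msc_nth
      by simp
    then have "realizes (tri_msc 1 0 1 1)"
      by (rule realizes_comb[OF fr M, rotated]) simp
    then show ?thesis
      by simp
  next
    case False
    obtain d where "d ^ 2 = - (s * s + r)"
      using nth_root_exists[of 2] by auto
    then have d: "s * s + r = - (d * d)"
      by (simp add: power2_eq_square)
    then have "d \<noteq> 0"
      using False by auto
    have sq_sum: "2 * s / (d * d) + s / (d * d) = 0"
      using three by (simp flip: add_divide_distrib)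
    have ff: "s * s / (d * d) + r / (d * d) = -1"
      using d \<open>d \<noteq> 0\<close> by (simp add: power2_eq_square flip: add_divide_distrib)
    have "has_msc (comb e f (-1) 0) (comb e f (s / d) (1 / d)) J2_msc"
      using d \<open>d \<noteq> 0\<close>
      unfolding has_msc_def mul_comb[OF M] comb_comb comb_eq_iff[OF fr] msc_nth
      by (simp add: sq_sum ff)
    then have "realizes J2_msc"
      by (rule realizes_comb[OF fr M, rotated]) (simp add: \<open>d \<noteq> 0\<close>)
    then show ?thesis
      by simp
  qed
qed

text \<open>
  Take the basis of \<open>idempotent_msc\<close>, where \<open>e f = b f\<close>, \<open>f e = c f\<close> and \<open>f f = r e + s f\<close>.  The Jordan identity for \<open>f, f\<close> forces \<open>r = 0\<close> or \<open>c = 1\<close>.  If \<open>r = s = 0\<close>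
  the algebra is triangular.  If \<open>r = 0\<close> and \<open>s \<noteq> 0\<close>, then a multiple of \<open>f\<close> is a second idempotent,
  and the algebra has a unit, which is \<open>e\<close> when \<open>b = 1\<close> and \<open>e + f / s\<close> when \<open>b = 0\<close>.  If
  \<open>r \<noteq> 0\<close>, then \<open>b = 1\<close>, where \<open>e\<close> is a unit, or \<open>b = -1\<close> and \<open>s = 0\<close>, which is \<open>J1\<close>.
\<close>

lemma idempotent_cases:
  assumes "e \<noteq> 0" "mul e e = e"
  shows "(\<exists>a s b c. realizes (tri_msc a s b c)) \<or>
    realizes J1_msc \<or> realizes J2_msc"
proof -
  obtain f r b c s where fr: "frame e f" and M: "has_msc e f (msc 1 0 0 r 0 b c s)"
    using idempotent_msc[OF assms] .
  have real: "realizes (msc 1 0 0 r 0 b c s)"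
    using fr M unfolding realizes_def by blast
  have lin: "mul (mul (comb e f 0 1) v) (mul (comb e f 0 1) (comb e f 1 0) + mul (comb e f 1 0) (comb e f 0 1)) +
        mul (mul (comb e f 1 0) v) (mul (comb e f 0 1) (comb e f 0 1)) =
      mul (comb e f 0 1) (mul v (mul (comb e f 0 1) (comb e f 1 0) + mul (comb e f 1 0) (comb e f 0 1))) +
        mul (comb e f 1 0) (mul v (mul (comb e f 0 1) (comb e f 0 1)))" for v
    by (rule jordan_linearized)
  have jf: "c * c * r + c * s * s = r * c + s * s * b"
    using jordan_identity[of "comb e f 0 1" "comb e f 1 0"]
    unfolding mul_comb[OF M] comb_add comb_eq_iff[OF fr] msc_nth by (elim conjE) algebra
  have jff: "r * r * (1 - c) = 0"
    using jordan_identity[of "comb e f 0 1" "comb e f 0 1"]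
    unfolding mul_comb[OF M] comb_add comb_eq_iff[OF fr] msc_nth by (elim conjE) algebra
  have le: "r * c * (b + c) = r * b * (b + c)"
    using lin[of "comb e f 1 0"]
    unfolding mul_comb[OF M] comb_add comb_eq_iff[OF fr] msc_nth by (elim conjE) algebra
  have le2: "s * c * (b + c) + s * b = s * b * (b + c) + s * b * b"
    using lin[of "comb e f 1 0"]
    unfolding mul_comb[OF M] comb_add comb_eq_iff[OF fr] msc_nth by (elim conjE) algebra
  have unital: ?thesis if "b = 1" "c = 1"
    using unital_cases[of r s] real that by blast
  show ?thesis
  proof (cases "r = 0")
    case r: True
    show ?thesis
    proof (cases "s = 0")
      case True
      then show ?thesis
        using real r by blast
    next
      case s: False
      then have "b = c"
        using jf r by simp
      then have "b = b * b"
        using le2 s by (simp add: algebra_simps)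
      then consider "b = 0" | "b = 1"
        by auto
      then show ?thesis
      proof cases
        case 1
        have "has_msc (comb e f 1 (1 / s)) (comb e f 0 1) (msc 1 0 0 0 0 1 1 s)"
          unfolding has_msc_def mul_comb[OF M] comb_comb comb_eq_iff[OF fr] msc_nth
          using 1 \<open>b = c\<close> r s by simp
        then have "realizes (msc 1 0 0 0 0 1 1 s)"
          by (rule realizes_comb[OF fr M, rotated]) simp
        then show ?thesis
          using unital_cases by blast
      next
        case 2
        then show ?thesis
          using unital \<open>b = c\<close> by simp
      qed
    qed
  next
    case r: False
    then have c: "c = 1"
      using jff by simp
    show ?thesis
    proof (cases "b = 1")
      case True
      then show ?thesis
        using unital c by simp
    next
      case b: False
      have "s * s * (1 - b) = 0"
        using jf c by (simp add: algebra_simps)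
      then have "s = 0"
        using b by simp
      have "(1 - b) * (b + 1) = 0"
        using le r c by (simp add: algebra_simps)
      then have "b = -1"
        using b by (simp add: add_eq_0_iff2)
      obtain d where d: "d ^ 2 = - r"
        using nth_root_exists[of 2] by auto
      then have "d \<noteq> 0"
        using r by auto
      have "has_msc (comb e f (-1) 0) (comb e f 0 (1 / d)) J1_msc"
        using d \<open>d \<noteq> 0\<close> r \<open>s = 0\<close> \<open>b = -1\<close> c
        unfolding has_msc_def mul_comb[OF M] comb_comb comb_eq_iff[OF fr] msc_nth
        by (simp add: divide_simps power2_eq_square)
      then have "realizes J1_msc"
        by (rule realizes_comb[OF fr M, rotated]) (simp add: \<open>d \<noteq> 0\<close>)
      then show ?thesis
        by simp
    qed
  qed
qed

text \<open>
  Write \<open>e f = p e + b f\<close> and \<open>f e = q e + c f\<close>.  The linearized identity gives \<open>b = 0\<close> or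
  \<open>c = -b\<close>.  If \<open>b = c = 0\<close>, then \<open>e\<close> spans an ideal of square zero.  Otherwise \<open>f\<close> can be shifted by a
  multiple of \<open>e\<close> until \<open>f e\<close> is a multiple of \<open>f\<close>, and then the identity forces \<open>f f = 0\<close>.  The only
  algebra obtained in this way that is not triangular has \<open>e f = p e\<close> and \<open>f e = c f\<close> with \<open>p, c \<noteq> 0\<close>;
  it contains the idempotent \<open>e / c + f / p\<close>.
\<close>

lemma square_zero_cases:
  assumes "e \<noteq> 0" "mul e e = 0"
  shows "(\<exists>a s b c. realizes (tri_msc a s b c)) \<or> (\<exists>u. u \<noteq> 0 \<and> mul u u = u)"
proof -
  obtain f where fr: "frame e f"
    using frame_extend[OF assms(1)] .
  obtain a1 p q r b1 b c s where M0: "has_msc e f (msc a1 p q r b1 b c s)"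
    using frame_has_msc[OF fr] .
  have "comb e f a1 b1 = 0"
    using M0 assms(2) by (simp add: has_msc_def msc_nth)
  then have "a1 = 0" "b1 = 0"
    by (simp_all add: comb_eq_0_iff[OF fr])
  then have M: "has_msc e f (msc 0 p q r 0 b c s)"
    using M0 by simp
  have b_cases: "b * b * (b + c) = 0"
    using jordan_linearized[of "comb e f 1 0" "comb e f 1 0" "comb e f 0 1"]
    unfolding mul_comb[OF M] comb_add comb_eq_iff[OF fr] msc_nth by (elim conjE) algebra
  have shift: "\<exists>f' r' s'. frame e f' \<and> has_msc e f' (msc 0 (p - b * t) (q - c * t) r' 0 b c s')" for t
  proof -
    define f' where "f' = comb e f t 1"
    have fr': "frame e f'"
      using frame_comb_iff[OF fr, of 1 0 t 1] by (simp add: f'_def comb_unit)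
    obtain r' s' where "mul f' f' = comb e f' r' s'"
      using frame_span[OF fr'] .
    moreover have "mul e f' = comb e f' (p - b * t) b"
      using mul_comb[OF M, of 1 0 t 1] comb_comb[of e f 1 0 t 1]
      by (simp add: f'_def comb_unit msc_nth)
    moreover have "mul f' e = comb e f' (q - c * t) c"
      using mul_comb[OF M, of t 1 1 0] comb_comb[of e f 1 0 t 1]
      by (simp add: f'_def comb_unit msc_nth)
    ultimately have "has_msc e f' (msc 0 (p - b * t) (q - c * t) r' 0 b c s')"
      using assms(2) by (simp add: has_msc_def msc_nth comb_unit)
    with fr' show ?thesis
      by blast
  qed
  show ?thesis
  proof (cases "b = 0")
    case b: True
    show ?thesis
    proof (cases "c = 0")
      case True
      then have "realizes (tri_msc s r q p)"
        using realizes_swap[of 0 p q r 0 0 0 s] fr M b unfolding realizes_def by blast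
      then show ?thesis
        by blast
    next
      case c: False
      obtain f' r' s' where fr': "frame e f'" and M': "has_msc e f' (msc 0 p 0 r' 0 0 c s')"
        using shift[of "q / c"] b c by auto
      have "c * c * r' = 0"
        using jordan_linearized[of "comb e f' 0 1" "comb e f' 1 0" "comb e f' 1 0"]
        unfolding mul_comb[OF M'] comb_add comb_eq_iff[OF fr'] msc_nth by (elim conjE) algebra
      moreover have "c * c * s' = 0"
        using jordan_linearized[of "comb e f' 0 1" "comb e f' 1 0" "comb e f' 1 0"]
        unfolding mul_comb[OF M'] comb_add comb_eq_iff[OF fr'] msc_nth by (elim conjE) algebra
      ultimately have M': "has_msc e f' (msc 0 p 0 0 0 0 c 0)"
        using M' c by simp
      show ?thesis
      proof (cases "p = 0")
        case True
        then show ?thesis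
          using fr' M' unfolding realizes_def by blast
      next
        case False
        define u where "u = comb e f' (1 / c) (1 / p)"
        have "mul u u = u"
          unfolding u_def mul_comb[OF M'] comb_eq_iff[OF fr'] msc_nth using c False by simp
        moreover have "u \<noteq> 0"
          using c by (simp add: u_def comb_eq_0_iff[OF fr'])
        ultimately show ?thesis
          by blast
      qed
    qed
  next
    case b: False
    then have c: "c = - b"
      using b_cases by (simp add: add_eq_0_iff2 add_eq_0_iff)
    have "b * (p + q) * (p + q) = 0"
      using jordan_linearized[of "comb e f 1 0" "comb e f 0 1" "comb e f 0 1"] c
      unfolding mul_comb[OF M] comb_add comb_eq_iff[OF fr] msc_nth by (elim conjE) algebra
    then have q: "q = - p"
      using b by (simp add: add_eq_0_iff)
    obtain f' r s where fr': "frame e f'" and M': "has_msc e f' (msc 0 0 0 r 0 b (- b) s)"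
      using shift[of "p / b"] b c q by auto
    have "s * b * b = 0"
      using jordan_linearized[of "comb e f' 0 1" "comb e f' 1 0" "comb e f' 1 0"]
      unfolding mul_comb[OF M'] comb_add comb_eq_iff[OF fr'] msc_nth by (elim conjE) algebra
    moreover have "b * b * r + b * s * s + b * s * s= 0"
      using jordan_identity[of "comb e f' 0 1" "comb e f' 1 0"]
      unfolding mul_comb[OF M'] comb_add comb_eq_iff[OF fr'] msc_nth by (elim conjE) algebra
    ultimately have "r = 0" "s = 0"
      using b by auto
    then show ?thesis
      using fr' M' unfolding realizes_def by blast
  qed
qed

lemma normal_forms:
  "(\<exists>a s b c. realizes (tri_msc a s b c)) \<or>
    realizes J1_msc \<or> realizes J2_msc"
proof -
  obtain e l where e: "e \<noteq> 0" "mul e e = scale l e"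
    using eigenvector_exists by blast
  show ?thesis
  proof (cases "l = 0")
    case True
    then show ?thesis
      using square_zero_cases[OF e(1)] e(2) idempotent_cases by auto
  next
    case False
    then have "mul (scale (1 / l) e) (scale (1 / l) e) = scale (1 / l) e"
      by (simp add: mul_linear e)
    moreover have "scale (1 / l) e \<noteq> 0"
      using False e(1) by simp
    ultimately show ?thesis
      by (rule idempotent_cases[rotated])
  qed
qed

lemma tri_rescale:
  assumes "realizes (tri_msc a s b c)" "x \<noteq> 0" "w \<noteq> 0"
  shows "realizes (tri_msc (x * a) (x * x * s / w) (x * b) (x * c))"
proof -
  obtain e f where fr: "frame e f" and M: "has_msc e f (tri_msc a s b c)"
    using assms(1) unfolding realizes_def by blast
  have "has_msc (comb e f x 0) (comb e f 0 w) (tri_msc (x * a) (x * x * s / w) (x * b) (x * c))"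
    unfolding has_msc_def mul_comb[OF M] comb_comb comb_eq_iff[OF fr] msc_nth using assms(3) by simp
  then show ?thesis
    by (rule realizes_comb[OF fr M, rotated]) (simp add: assms)
qed

text \<open>
  Replacing \<open>e\<close> by \<open>e + t f\<close> changes \<open>s\<close> by \<open>t (b + c - a)\<close>, so \<open>s\<close> can be removed unless
  \<open>b + c = a\<close>.  In that case a nonzero \<open>s\<close> can only be scaled to 1.
\<close>

lemma tri_normalise:
  assumes "realizes (tri_msc a s b c)"
  obtains "realizes (tri_msc a 0 b c)"
  | "realizes (tri_msc a 1 b c)" "b + c = a" "b * b = a * c"
proof (cases "s = 0")
  case True
  then show ?thesis
    using assms that by simp
next
  case s: False
  show ?thesis
  proof (cases "b + c = a")
    case True
    then show ?thesis
      using that(2) tri_rescale[OF assms, of 1 s] tri_conditions(2)[OF assms] s by simp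
  next
    case False
    obtain e f where fr: "frame e f" and M: "has_msc e f (tri_msc a s b c)"
      using assms unfolding realizes_def by blast
    \<comment> \<open>The scalar \<open>t = s / (a - b - c)\<close> solves \<open>s + t (b + c - a) = 0\<close>.\<close>
    have "has_msc (comb e f 1 (s / (a - b - c))) (comb e f 0 1) (tri_msc a 0 b c)"
      unfolding has_msc_def mul_comb[OF M] comb_comb comb_eq_iff[OF fr] msc_nth
      using False by (simp add: divide_simps) (auto simp: algebra_simps)
    then have "realizes (tri_msc a 0 b c)"
      by (rule realizes_comb[OF fr M, rotated]) simp
    then show ?thesis
      by (rule that)
  qed
qed

section \<open>Every triangular algebra is in the list\<close>

text \<open>
  With \<open>c = 1 - a\<close> the factor \<open>b\<^sup>2 - a c\<close> vanishes on \<open>J4\<close> and \<open>J5\<close>, and \<open>b + c - a\<close> on \<open>J3\<close>.  A value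
  of \<open>a\<close> that \<open>J3\<close> excludes makes both factors vanish, hence belongs to the first case.
\<close>

lemma tri_has_label_sum_1:
  fixes i :: 'a and rt :: "'a \<Rightarrow> 'a"
  assumes i: "i * i = -1" and rt: "\<And>a. (rt a)\<^sup>2 = a"
    and real: "realizes (tri_msc a 0 b c)" and ac: "a + c = 1"
  shows "\<exists>l. admissible i l \<and> realizes (label_msc i rt l)"
proof -
  have c: "c = - a + 1"
    using ac by (simp add: algebra_simps)
  show ?thesis
  proof (cases "b * b = a * c")
    case True
    then have "b\<^sup>2 = a - a\<^sup>2"
      unfolding c by (simp add: power2_eq_square algebra_simps)
    then have "b\<^sup>2 = (rt (a - a\<^sup>2))\<^sup>2"
      by (simp only: rt)
    then consider "b = rt (a - a\<^sup>2)" | "b = - rt (a - a\<^sup>2)" "b \<noteq> rt (a - a\<^sup>2)"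
      unfolding power2_eq_iff by blast
    then show ?thesis
    proof cases
      case 1
      then show ?thesis
        using real c by (intro exI[of _ "J4 a"]) simp
    next
      case 2
      \<comment> \<open>For these two values the square root is zero, so the two signs coincide.\<close>
      have "a \<noteq> 0 \<and> a \<noteq> 1"
        using 2 rt[of 0] by auto
      then show ?thesis
        using real c 2 by (intro exI[of _ "J5 a"]) simp
    qed
  next
    case False
    then have "b + c = a"
      using tri_conditions(1)[OF real] by simp
    then have "b = 2 * a - 1"
      using c by (simp add: algebra_simps)
    then have b: "b = -1 - a"
      by (simp add: two_eq)
    have "a \<noteq> -1 + i"
    proof
      assume a: "a = -1 + i"
      then have "b = - i" "c = -1 - i"
        by (simp_all add: b c two_eq)
      then show False
        using False a root_of_minus_one[OF i two_eq] by simp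
    qed
    moreover have "a \<noteq> -1 - i"
    proof
      assume a: "a = -1 - i"
      then have "b = i" "c = -1 + i"
        by (simp_all add: b c two_eq)
      then show False
        using False a root_of_minus_one[OF i two_eq] by (simp add: mult.commute)
    qed
    ultimately show ?thesis
      using real c b by (intro exI[of _ "J3 a"]) simp
  qed
qed

text \<open>
  The remaining cases are \<open>s = 0\<close> with \<open>a + c = 0\<close>, where the conditions read
  \<open>(b - i a) (b + i a) (b + a) = 0\<close>, and \<open>s = 1\<close> with \<open>b + c = a\<close> and \<open>b\<^sup>2 = a c\<close>, where
  \<open>(b - (1 + i) a) (b - (1 - i) a) = 0\<close>.  Every factor is a label up to rescaling.
\<close>

lemma tri_has_label:
  fixes i :: 'a and rt :: "'a \<Rightarrow> 'a"
  assumes i: "i * i = -1" and rt: "\<And>a. (rt a)\<^sup>2 = a"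
    and real: "realizes (tri_msc a s b c)" and nontriv: "nontrivial_mul mul"
  shows "\<exists>l. admissible i l \<and> realizes (label_msc i rt l)"
  using real
proof (cases rule: tri_normalise)
  case 1
  have nz: "\<not> (a = 0 \<and> b = 0 \<and> c = 0)"
  proof
    assume "a = 0 \<and> b = 0 \<and> c = 0"
    then obtain e f where fr: "frame e f" and M: "has_msc e f (tri_msc 0 0 0 0)"
      using 1 unfolding realizes_def by blast
    have "mul u v = 0" for u v
    proof -
      obtain x y where u: "u = comb e f x y"
        using frame_span[OF fr] .
      obtain z w where v: "v = comb e f z w"
        using frame_span[OF fr] .
      show ?thesis
        unfolding u v mul_comb[OF M] by (simp add: msc_nth comb_unit)
    qed
    then show False
      using nontriv by (simp add: nontrivial_mul_def)
  qed
  note scaled = tri_rescale[OF 1, of _ 1, simplified]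
  show ?thesis
  proof (cases "a + c = 0")
    case False
    have "realizes (tri_msc (1 / (a + c) * a) 0 (1 / (a + c) * b) (1 / (a + c) * c))"
      using scaled[of "1 / (a + c)"] False by simp
    then show ?thesis
      by (rule tri_has_label_sum_1[OF i rt]) (use False in \<open>simp flip: add_divide_distrib\<close>)
  next
    case True
    then have c: "c = - a"
      by (simp add: add_eq_0_iff)
    then have "(b * b + a * a) * (b + a) = 0"
      using tri_conditions(1)[OF 1] two_eq by (simp add: algebra_simps)
    moreover have "b * b + a * a = (b - i * a) * (b + i * a)"
      using root_of_minus_one[OF i two_eq] by (simp add: algebra_simps)
    ultimately have prod: "(b - i * a) * (b + i * a) * (b + a) = 0"
      by simp
    have a: "a \<noteq> 0"
    proof
      assume "a = 0"
      then show False
        using prod nz c by simp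
    qed
    consider "b = i * a" | "b = - (i * a)" | "b = - a"
      using prod unfolding mult_eq_0_iff right_minus_eq add_eq_0_iff2 by blast
    then show ?thesis
    proof cases
      case 1
      \<comment> \<open>The scalar is the quotient of the first parameter of the label by \<open>a\<close>.\<close>
      have "b = a * i" "c = a * (-1)"
        using 1 c by (simp_all add: algebra_simps)
      then have "(-1 + i) / a * b = (-1 + i) * i" "(-1 + i) / a * c = (-1 + i) * (-1)"
        using a by simp_all
      then have "(-1 + i) / a * b = -1 - i" "(-1 + i) / a * c = 1 - i"
        using root_of_minus_one[OF i two_eq] by (simp_all add: algebra_simps two_eq)
      then have "realizes (label_msc i rt J8)"
        using scaled[of "(-1 + i) / a"] a root_of_minus_one[OF i two_eq] by simp
      then show ?thesis
        by (intro exI[of _ J8]) simp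
    next
      case 2
      have "b = a * (- i)" "c = a * (-1)"
        using 2 c by (simp_all add: algebra_simps)
      then have "(-1 - i) / a * b = (-1 - i) * (- i)" "(-1 - i) / a * c = (-1 - i) * (-1)"
        using a by simp_all
      then have "(-1 - i) / a * b = -1 + i" "(-1 - i) / a * c = 1 + i"
        using root_of_minus_one[OF i two_eq] by (simp_all add: algebra_simps two_eq)
      then have "realizes (label_msc i rt J9)"
        using scaled[of "(-1 - i) / a"] a root_of_minus_one[OF i two_eq] by simp
      then show ?thesis
        by (intro exI[of _ J9]) simp
    next
      case 3
      then have "realizes (tri_msc (-1) 0 1 1)"
        using scaled[of "-1 / a"] a c by simp
      then show ?thesis
        using realizes_swap by (intro exI[of _ J10]) force
    qed
  qed
next
  case 2
  show ?thesis
  proof (cases "a = 0")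
    case True
    then show ?thesis
      using 2 by (intro exI[of _ J11]) simp
  next
    case a: False
    have c: "c = a - b"
      using 2(2) by (simp add: algebra_simps)
    have scaled: "x \<noteq> 0 \<Longrightarrow> realizes (tri_msc (x * a) 1 (x * b) (x * c))" for x
      using tri_rescale[OF 2(1), of x "x * x"] by simp
    have "b * b = a * a - a * b"
      using 2(3) c by (simp add: algebra_simps)
    moreover have "(b - a * (1 + i)) * (b - a * (1 - i)) = b * b - 2 * (a * b) + a * a * (1 - i * i)"
      by (simp add: algebra_simps)
    ultimately have "(b - a * (1 + i)) * (b - a * (1 - i)) = 0"
      using root_of_minus_one[OF i two_eq] by (simp add: two_eq)
    then consider "b = a * (1 + i)" | "b = a * (1 - i)"
      by auto
    then show ?thesis
    proof cases
      case 1
      have "b = a * (1 + i)" "c = a * (- i)"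
        using 1 c by (simp_all add: algebra_simps)
      then have "(-1 - i) / a * b = (-1 - i) * (1 + i)" "(-1 - i) / a * c = (-1 - i) * (- i)"
        using a by simp_all
      then have "(-1 - i) / a * b = i" "(-1 - i) / a * c = -1 + i"
        using root_of_minus_one[OF i two_eq] by (simp_all add: algebra_simps two_eq)
      then have "realizes (label_msc i rt J7)"
        using scaled[of "(-1 - i) / a"] a root_of_minus_one[OF i two_eq] by simp
      then show ?thesis
        by (intro exI[of _ J7]) simp
    next
      case 2
      have "b = a * (1 - i)" "c = a * i"
        using c unfolding 2 by (simp_all add: algebra_simps)
      then have "(-1 + i) / a * b = (-1 + i) * (1 - i)" "(-1 + i) / a * c = (-1 + i) * i"
        using a by simp_all
      then have "(-1 + i) / a * b = - i" "(-1 + i) / a * c = -1 - i"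
        using root_of_minus_one[OF i two_eq] by (simp_all add: algebra_simps two_eq)
      then have "realizes (label_msc i rt J6)"
        using scaled[of "(-1 + i) / a"] a root_of_minus_one[OF i two_eq] by simp
      then show ?thesis
        by (intro exI[of _ J6]) simp
    qed
  qed
qed

end

section \<open>The labels are pairwise non-isomorphic\<close>

text \<open>
  The parameters \<open>(a, s, b, c)\<close> of the triangular form of a label.  \<open>J10\<close> is triangular with respect
  to the interchanged basis.  The value for \<open>J1\<close> and \<open>J2\<close> is a dummy.
\<close>

fun tri_entries :: "'a::field \<Rightarrow> ('a \<Rightarrow> 'a) \<Rightarrow> 'a label \<Rightarrow> 'a \<times> 'a \<times> 'a \<times> 'a" where
  "tri_entries i rt (J3 a) = (a, 0, - 1 - a, - a + 1)"
| "tri_entries i rt (J4 a) = (a, 0, rt (a - a\<^sup>2), - a + 1)"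
| "tri_entries i rt (J5 a) = (a, 0, - rt (a - a\<^sup>2), - a + 1)"
| "tri_entries i rt J6 = (- 1 + i, 1, - i, - 1 - i)"
| "tri_entries i rt J7 = (- 1 - i, 1, i, - 1 + i)"
| "tri_entries i rt J8 = (- 1 + i, 0, - 1 - i, 1 - i)"
| "tri_entries i rt J9 = (- 1 - i, 0, - 1 + i, 1 + i)"
| "tri_entries i rt J10 = (- 1, 0, 1, 1)"
| "tri_entries i rt J11 = (0, 1, 0, 0)"
| "tri_entries i rt _ = (0, 0, 0, 0)"

lemma (in plane_algebra) realizes_tri_entries:
  assumes "realizes (label_msc i rt l)" "l \<noteq> J1" "l \<noteq> J2" "tri_entries i rt l = (a, s, b, c)"
  shows "realizes (tri_msc a s b c)"
  using assms realizes_swap[of 0 1 1 0 0 0 0 "-1"] by (cases l) auto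

text \<open>
  The condition \<open>s \<noteq> 0\<close> singles out the pair \<open>J6\<close>, \<open>J7\<close>, and \<open>b\<^sup>2 \<noteq> a c\<close> singles out \<open>J3\<close>.  On \<open>J3\<close> the
  difference \<open>b\<^sup>2 - a c\<close> is \<open>-(a + 1 - i) (a + 1 + i)\<close>, which is nonzero for admissible parameters.
\<close>

lemma label_of_entries_sum_1:
  fixes i :: "'a::field"
  assumes i: "i * i = -1" and rt: "\<And>a. rt a * rt a = a" and two: "(2 :: 'a) = -1"
    and adm: "admissible i l" and l: "tri_entries i rt l = (a, s, b, c)" and sum: "a + c = 1"
  shows "l = (if s \<noteq> 0 then if b = - i then J6 else J7
              else if b * b \<noteq> a * c then J3 a else if b = rt (a - a\<^sup>2) then J4 a else J5 a)"
    and "s \<noteq> 0 \<Longrightarrow> b + c = a"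
proof -
  have not_J3: "b * b \<noteq> a * c" if "l = J3 a"
  proof
    assume *: "b * b = a * c"
    have bc: "b = -1 - a" "c = - a + 1"
      using l that by simp_all
    have "(a - (-1 + i)) * (a - (-1 - i)) = a * a + 2 * a + (1 - i * i)"
      by (simp add: algebra_simps)
    also have "\<dots> = - (b * b - a * c)"
      unfolding bc i by (simp add: algebra_simps two)
    finally have "(a - (-1 + i)) * (a - (-1 - i)) = 0"
      by (simp add: *)
    then show False
      using adm that unfolding mult_eq_0_iff right_minus_eq by simp
  qed
  have not_J5: "- rt (a - a\<^sup>2) \<noteq> rt (a - a\<^sup>2)" if "l = J5 a"
  proof
    assume "- rt (a - a\<^sup>2) = rt (a - a\<^sup>2)"
    then have "a - a\<^sup>2 = 0"
      using rt[of "a - a\<^sup>2"] eq_minus_self[OF two] by (metis mult_zero_left)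
    then have "a * (1 - a) = 0"
      by (simp add: power2_eq_square algebra_simps)
    then show False
      using adm that by simp
  qed
  have rt': "rt (a - a\<^sup>2) * rt (a - a\<^sup>2) = a * (- a + 1)"
    unfolding rt by (simp add: power2_eq_square algebra_simps)
  show "l = (if s \<noteq> 0 then if b = - i then J6 else J7
              else if b * b \<noteq> a * c then J3 a else if b = rt (a - a\<^sup>2) then J4 a else J5 a)"
  proof (cases l)
        case (J3 x)
    then show ?thesis using l not_J3 by auto
  next
    case (J4 x)
    then show ?thesis using l rt' by auto
  next
    case (J5 x)
    then show ?thesis using l not_J5 rt' by auto
  next
    case J6
    then show ?thesis using l by auto
  next
    case J7
    then show ?thesis using l root_of_minus_one_distinct(1)[OF i two] by auto
  qed (use l sum in auto)
  have "- i + (- 1 - i) = - 1 - (i + i)" "i + (- 1 + i) = - 1 + (i + i)"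
    by simp_all
  then have "- i + (- 1 - i) = - 1 + i" "i + (- 1 + i) = - 1 - i"
    unfolding root_of_minus_one(3)[OF i two] by simp_all
  then show "b + c = a" if "s \<noteq> 0"
    using l that by (cases l) auto
qed

text \<open>
  The conditions that select the label are homogeneous in \<open>(a, b)\<close>, so it depends on \<open>(a, b, c)\<close> only up
  to a common scalar.
\<close>

lemma label_of_entries_sum_0:
  fixes i :: "'a::field"
  assumes i: "i * i = -1" and two: "(2 :: 'a) = -1"
    and l: "tri_entries i rt l = (a, s, b, c)" and sum: "a + c = 0"
    and nz: "\<not> (a = 0 \<and> b = 0 \<and> c = 0)"
  shows "l = (if b = i * a then J8 else if b = - (i * a) then J9 else J10)"
proof -
  note i_distinct = root_of_minus_one_distinct[OF i two]
  have prod: "i * (- 1 + i) = - 1 - i" "i * (- 1 - i) = 1 - i"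
    by (simp_all add: algebra_simps i)
  have neq: "1 - i \<noteq> - 1 + i"
    using eq_minus_self[OF two, of "1 - i"] i_distinct(2) by auto
  have two_neq: "- 2 \<noteq> (0 :: 'a)"
    by (simp add: two)
  show ?thesis
  proof (cases l)
    case J6
    then show ?thesis using l sum two_neq by auto
  next
    case J7
    then show ?thesis using l sum two_neq by auto
  next
    case J8
    then have "a = - 1 + i" "b = - 1 - i"
      using l by simp_all
    then show ?thesis using J8 prod by simp
  next
    case J9
    then have "a = - 1 - i" "b = - (1 - i)"
      using l by simp_all
    then show ?thesis using J9 prod neq by simp
  next
    case J10
    then have "a = - 1" "b = 1"
      using l by simp_all
    then show ?thesis using J10 i_distinct(2,3) minus_equation_iff[of i 1] by auto
  qed (use l sum nz in auto)
qed

context plane_algebra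
begin

text \<open>
  Every triangular label other than \<open>J11\<close> has \<open>a + c = 1\<close> or \<open>a + c = 0\<close>.  Since \<open>a + c\<close> scales with
  \<open>(a, b, c)\<close>, isomorphic labels have the same value of it, and in the first case the scalar is 1.
\<close>

lemma label_unique:
  fixes i :: 'a
  assumes i: "i * i = -1" and rt: "\<And>a. rt a * rt a = a" and two: "(2 :: 'a) = -1"
    and adm: "admissible i l" "admissible i l'"
    and real: "realizes (label_msc i rt l)" "realizes (label_msc i rt l')"
  shows "l = l'"
proof -
  have two0: "(2 :: 'a) \<noteq> 0"
    by (simp add: two)
  have tri: "\<exists>a s b c. realizes (tri_msc a s b c)"
    if "realizes (label_msc i rt l)" "l \<noteq> J1" "l \<noteq> J2" for l
    using realizes_tri_entries[OF that] by (metis prod_cases4)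
  show ?thesis
  proof (cases "l \<in> {J1, J2} \<or> l' \<in> {J1, J2}")
    case True
    have J1: "l = J1" if "realizes (label_msc i rt l)" "realizes (label_msc i rt J1)" for l
      using tri[OF that(1)] that J1_not_tri[OF _ two0] J1_J2_exclusive[OF _ two0]
      by (cases "l = J2") auto
    have J2: "l = J2" if "realizes (label_msc i rt l)" "realizes (label_msc i rt J2)" for l
      using tri[OF that(1)] that J2_not_tri[OF _ two0] J1_J2_exclusive[OF _ two0]
      by (cases "l = J1") auto
    show ?thesis
      using True J1[of l] J1[of l'] J2[of l] J2[of l'] real by blast
  next
    case False
    obtain a s b c where l: "tri_entries i rt l = (a, s, b, c)"
      using prod_cases4 by blast
    obtain a' s' b' c' where l': "tri_entries i rt l' = (a', s', b', c')"
      using prod_cases4 by blast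
    have real': "realizes (tri_msc a s b c)" "realizes (tri_msc a' s' b' c')"
      using realizes_tri_entries[OF real(1) _ _ l] realizes_tri_entries[OF real(2) _ _ l'] False
      by auto
    have zero: "l = J11 \<longleftrightarrow> a = 0 \<and> b = 0 \<and> c = 0"
      if "l \<noteq> J1" "l \<noteq> J2" "tri_entries i rt l = (a, s, b, c)" for l a s b c
      using that root_of_minus_one_distinct[OF i two] by (cases l) (auto simp: add_eq_0_iff)
    have sum: "a + c = 0 \<or> a + c = 1"
      if "tri_entries i rt l = (a, s, b, c)" for l a s b c
      using that by (cases l) (auto simp: two)
    show ?thesis
    proof (cases "l = J11 \<or> l' = J11")
      case True
      have "a = 0 \<and> b = 0 \<and> c = 0 \<longleftrightarrow> a' = 0 \<and> b' = 0 \<and> c' = 0"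
      proof (rule iffI; rule ccontr)
        assume zero: "a = 0 \<and> b = 0 \<and> c = 0" and nz: "\<not> (a' = 0 \<and> b' = 0 \<and> c' = 0)"
        obtain x where "x \<noteq> 0" "a = x * a'" "b = x * b'" "c = x * c'"
          using tri_unique[OF real'(2,1) nz] by blast
        then show False
          using zero nz by simp
      next
        assume zero: "a' = 0 \<and> b' = 0 \<and> c' = 0" and nz: "\<not> (a = 0 \<and> b = 0 \<and> c = 0)"
        obtain x where "x \<noteq> 0" "a' = x * a" "b' = x * b" "c' = x * c"
          using tri_unique[OF real' nz] by blast
        then show False
          using zero nz by simp
      qed
      then show ?thesis
        using True zero[OF _ _ l] zero[OF _ _ l'] False by blast
    next
      case nz: False
      then have nonzero: "\<not> (a = 0 \<and> b = 0 \<and> c = 0)" "\<not> (a' = 0 \<and> b' = 0 \<and> c' = 0)"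
        using zero[OF _ _ l] zero[OF _ _ l'] False by blast+
      obtain x where x: "x \<noteq> 0" "a' = x * a" "b' = x * b" "c' = x * c"
        and ss: "b + c = a \<Longrightarrow> s = 0 \<longleftrightarrow> s' = 0"
        using tri_unique[OF real' nonzero(1)] by blast
      have sum': "a' + c' = x * (a + c)"
        by (simp add: x algebra_simps)
      show ?thesis
      proof (cases "a + c = 0")
        case True
        then have True': "a' + c' = 0"
          using sum' by simp
        have "b' = i * a' \<longleftrightarrow> b = i * a" "b' = - (i * a') \<longleftrightarrow> b = - (i * a)"
          using mult_left_cancel[OF x(1), of b "i * a"] mult_left_cancel[OF x(1), of b "- (i * a)"]
          unfolding x by (simp_all add: mult.left_commute)
        then show ?thesis
          using label_of_entries_sum_0[OF i two l True nonzero(1)] label_of_entries_sum_0[OF i two l' True' nonzero(2)]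
          by simp
      next
        case sum_nonzero: False
        then have s1: "a + c = 1" "x = 1"
          using sum[OF l] sum[OF l'] sum' x(1) by auto
        then have eq: "a' = a" "b' = b" "c' = c" "a' + c' = 1"
          using x by auto
        have "s = 0 \<longleftrightarrow> s' = 0"
          using ss label_of_entries_sum_1(2)[OF i rt two adm(1) l s1(1)] label_of_entries_sum_1(2)[OF i rt two adm(2) l' eq(4)]
          unfolding eq by blast
        then show ?thesis
          using label_of_entries_sum_1(1)[OF i rt two adm(1) l s1(1)] label_of_entries_sum_1(1)[OF i rt two adm(2) l' eq(4)]
          unfolding eq by simp
      qed
    qed
  qed
qed

end

theorem theorem3p3:
  fixes scale :: "'a::alg_closed_field \<Rightarrow> 'b::ab_group_add \<Rightarrow> 'b"
    and mul :: "'b \<Rightarrow> 'b \<Rightarrow> 'b"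
    and i :: 'a
    and rt :: "'a \<Rightarrow> 'a"
  assumes "CHAR('a) = 3"
    and "i\<^sup>2 = -1"
    and "\<And>a. (rt a)\<^sup>2 = a"
    and "jordan_algebra scale mul"
    and "vector_space.dim scale (UNIV :: 'b set) = 2"
    and "nontrivial_mul mul"
  shows "\<exists>!l. admissible i l \<and>
           isomorphic_algebras scale mul (*s) (msc_mul (label_msc i rt l))"
proof -
  interpret jordan_algebra scale mul
    by fact
  have "of_nat 3 = (0 :: 'a)"
    unfolding assms(1)[symmetric] by (rule of_nat_CHAR)
  then have three: "(3 :: 'a) = 0"
    by simp
  interpret jordan_plane scale mul
    by unfold_locales (fact assms(5), fact three)
  have "\<exists>l. admissible i l \<and> realizes (label_msc i rt l)"
    using normal_forms
  proof (elim disjE exE)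
    show ?thesis if "realizes (tri_msc a s b c)" for a s b c
      using tri_has_label[OF _ assms(3) that assms(6)] assms(2) by (simp add: power2_eq_square)
    show ?thesis if "realizes J1_msc"
      using that by (intro exI[of _ J1]) simp
    show ?thesis if "realizes J2_msc"
      using that by (intro exI[of _ J2]) simp
  qed
  moreover have "l = l'" if "admissible i l" "realizes (label_msc i rt l)"
      "admissible i l'" "realizes (label_msc i rt l')" for l l'
    using assms(2,3) unfolding power2_eq_square by (rule label_unique[OF _ _ two_eq that(1,3,2,4)])
  ultimately show ?thesis
    unfolding isomorphic_iff_realizes by blast
qed

end
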